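(* Let $L$ be a finite field and let $K$ be a proper subfield of $L$. Let $m$ be a positive integer with $m \leq |K|$ and let $C \subseteq L^m$ be a $K$-linear code. Then every $K$-linear isometry $f: C \to L^m$ is extendible, i.e. there is a $K$-monomial map $F: L^m \to L^m$ with $F|_C = f$. Moreover, for every integer $m > |K|$ there exist a $K$-linear code $C \subseteq L^m$ and a $K$-linear isometry $f: C \to L^m$ that is not extendible.
   Context: $L^m$ carries the Hamming weight $\mathrm{wt}(x) = |\{i : x_i \neq 0\}|$ and Hamming distance $\rho(x,y)=\mathrm{wt}(x-y)$. A $K$-linear code is a $K$-linear subspace of $L^m$. A $K$-linear isometry of $C$ is a $K$-linear map $f: C\to L^m$ preserving the Hamming distance (equivalently, preserving Hamming weight). $\mathrm{Aut}_K(L)$ denotes the group of invertible $K$-linear maps $L \to L$. A map $F: L^m \to L^m$ is $K$-monomial if there exist a permutation $\pi \in S_m$ and $g_1,\dots,g_m \in \mathrm{Aut}_K(L)$ such that $F(u_1,\dots,u_m) = (g_1(u_{\pi(1)}),\dots,g_m(u_{\pi(m)}))$ for all $u \in L^m$. A $K$-linear isometry of $C$ is called extendible if it is the restriction to $C$ of a $K$-monomial map. *)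

theory Defs
  imports "Jordan_Normal_Form.Matrix"
begin

text \<open>
  The field \<open>L\<close> is the type \<open>'a\<close>, the subfield \<open>K\<close> is a subset of it, and \<open>L\<^sup>m\<close> is
  \<^term>\<open>carrier_vec m\<close>, with coordinates indexed by \<open>0, \<dots>, m - 1\<close>. Maps defined on \<open>L\<^sup>m\<close> or on
  a code \<open>C\<close> are total functions on \<^typ>\<open>'a vec\<close> of which only the values on the
  respective domain are constrained.
\<close>

definition is_subfield :: "'a::field set \<Rightarrow> bool" where
  "is_subfield K \<longleftrightarrow>
     0 \<in> K \<and> 1 \<in> K \<and>
     (\<forall>a\<in>K. \<forall>b\<in>K. a + b \<in> K) \<and> (\<forall>a\<in>K. - a \<in> K) \<and>
     (\<forall>a\<in>K. \<forall>b\<in>K. a * b \<in> K) \<and> (\<forall>a\<in>K. a \<noteq> 0 \<longrightarrow> inverse a \<in> K)"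

definition hamming_weight :: "'a::zero vec \<Rightarrow> nat" where
  "hamming_weight x = card {i. i < dim_vec x \<and> x $ i \<noteq> 0}"

definition hamming_dist :: "'a::{zero,minus} vec \<Rightarrow> 'a vec \<Rightarrow> nat" where
  "hamming_dist x y = hamming_weight (x - y)"

definition linear_code :: "'a::field set \<Rightarrow> nat \<Rightarrow> 'a vec set \<Rightarrow> bool" where
  "linear_code K m C \<longleftrightarrow>
     C \<subseteq> carrier_vec m \<and> 0\<^sub>v m \<in> C \<and>
     (\<forall>x\<in>C. \<forall>y\<in>C. x + y \<in> C) \<and> (\<forall>a\<in>K. \<forall>x\<in>C. a \<cdot>\<^sub>v x \<in> C)"

definition linear_isometry ::
    "'a::field set \<Rightarrow> nat \<Rightarrow> 'a vec set \<Rightarrow> ('a vec \<Rightarrow> 'a vec) \<Rightarrow> bool" where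
  "linear_isometry K m C f \<longleftrightarrow>
     (\<forall>x\<in>C. f x \<in> carrier_vec m) \<and>
     (\<forall>x\<in>C. \<forall>y\<in>C. f (x + y) = f x + f y) \<and>
     (\<forall>a\<in>K. \<forall>x\<in>C. f (a \<cdot>\<^sub>v x) = a \<cdot>\<^sub>v f x) \<and>
     (\<forall>x\<in>C. \<forall>y\<in>C. hamming_dist (f x) (f y) = hamming_dist x y)"

text \<open>The \<open>K\<close>-linear (not necessarily multiplicative) bijections of \<open>L\<close>.\<close>

definition linear_aut :: "'a::field set \<Rightarrow> ('a \<Rightarrow> 'a) set" where
  "linear_aut K =
     {g. bij g \<and> (\<forall>x y. g (x + y) = g x + g y) \<and> (\<forall>a\<in>K. \<forall>x. g (a * x) = a * g x)}"

definition monomial_map :: "'a::field set \<Rightarrow> nat \<Rightarrow> ('a vec \<Rightarrow> 'a vec) \<Rightarrow> bool" where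
  "monomial_map K m F \<longleftrightarrow>
     (\<exists>\<pi> g. \<pi> permutes {..<m} \<and> (\<forall>i<m. g i \<in> linear_aut K) \<and>
        (\<forall>u\<in>carrier_vec m. F u = vec m (\<lambda>i. g i (u $ \<pi> i))))"

definition extendible ::
    "'a::field set \<Rightarrow> nat \<Rightarrow> 'a vec set \<Rightarrow> ('a vec \<Rightarrow> 'a vec) \<Rightarrow> bool" where
  "extendible K m C f \<longleftrightarrow> (\<exists>F. monomial_map K m F \<and> (\<forall>x\<in>C. F x = f x))"

end

theory Submission
  imports Defs "HOL-Combinatorics.Permutations" "HOL-Library.Multiset"
begin

text \<open>
  A map \<open>f\<close> preserves weights iff every codeword \<open>x\<close> lies in as many of the coordinate kernels
  \<open>V\<^sub>i = {x \<in> C. x\<^sub>i = 0}\<close> as of the kernels \<open>U\<^sub>i = {x \<in> C. (f x)\<^sub>i = 0}\<close>, and two \<open>K\<close>-linear maps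
  \<open>C \<rightarrow> L\<close> with the same kernel differ by an element of \<open>Aut\<^sub>K(L)\<close>; so \<open>f\<close> is extendible iff the
  \<open>V\<^sub>i\<close> and the \<open>U\<^sub>i\<close> form the same multiset.  A space over \<open>K\<close> is not a union of at most \<open>|K|\<close>
  proper subspaces.  Hence, for \<open>m \<le> |K|\<close>, a maximal member of one family, being covered
  by the other family, is contained in one of its members and equals it by maximality; cancel it
  and repeat.  For \<open>m > |K|\<close> the covering of \<open>K\<^sup>2\<close> by its \<open>|K| + 1\<close> lines gives the counterexample:
  the multiset of the lines and the multiset of \<open>K\<^sup>2\<close> and \<open>|K|\<close> copies of \<open>{0}\<close> cover every
  point equally often.
\<close>

section \<open>Subfields and linear codes\<close>

lemma is_subfieldD:
  assumes "is_subfield K"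
  shows "0 \<in> K" "1 \<in> K" "a \<in> K \<Longrightarrow> b \<in> K \<Longrightarrow> a + b \<in> K" "a \<in> K \<Longrightarrow> - a \<in> K"
    "a \<in> K \<Longrightarrow> b \<in> K \<Longrightarrow> a - b \<in> K" "a \<in> K \<Longrightarrow> b \<in> K \<Longrightarrow> a * b \<in> K"
    "a \<in> K \<Longrightarrow> inverse a \<in> K" "a \<in> K \<Longrightarrow> b \<in> K \<Longrightarrow> a / b \<in> K"
proof -
  show "0 \<in> K" "1 \<in> K" "a \<in> K \<Longrightarrow> b \<in> K \<Longrightarrow> a + b \<in> K" "a \<in> K \<Longrightarrow> - a \<in> K"
    using assms by (auto simp: is_subfield_def)
  have add: "x + y \<in> K" and mult: "x * y \<in> K" if "x \<in> K" "y \<in> K" for x y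
    using assms that by (auto simp: is_subfield_def)
  have inv: "inverse x \<in> K" and neg: "- x \<in> K" if "x \<in> K" for x
    using assms that by (cases "x = 0"; auto simp: is_subfield_def)+
  show "a \<in> K \<Longrightarrow> b \<in> K \<Longrightarrow> a - b \<in> K"
    using add[of a "- b"] neg[of b] by simp
  show "a \<in> K \<Longrightarrow> b \<in> K \<Longrightarrow> a * b \<in> K"
    by (rule mult)
  show "a \<in> K \<Longrightarrow> inverse a \<in> K"
    by (rule inv)
  show "a \<in> K \<Longrightarrow> b \<in> K \<Longrightarrow> a / b \<in> K"
    using mult[of a "inverse b"] inv[of b] by (simp add: divide_inverse)
qed

lemma linear_codeD:
  assumes "linear_code K m C"
  shows "C \<subseteq> carrier_vec m" "0\<^sub>v m \<in> C" "x \<in> C \<Longrightarrow> y \<in> C \<Longrightarrow> x + y \<in> C"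
    "a \<in> K \<Longrightarrow> x \<in> C \<Longrightarrow> a \<cdot>\<^sub>v x \<in> C" "x \<in> C \<Longrightarrow> dim_vec x = m"
  using assms by (auto simp: linear_code_def)

lemma linear_code_diff:
  fixes K :: "'a::field set"
  assumes "is_subfield K" "linear_code K m C" "x \<in> C" "y \<in> C"
  shows "x - y \<in> C"
proof -
  have "x - y = x + (-1) \<cdot>\<^sub>v y"
    using linear_codeD(5)[OF assms(2)] assms(3,4) by (intro eq_vecI) auto
  moreover have "-1 \<in> K"
    using is_subfieldD(2,4)[OF assms(1)] by blast
  ultimately show ?thesis
    using linear_codeD(3,4)[OF assms(2)] assms(3,4) by simp
qed

lemma linear_code_Int:
  assumes "linear_code K m C" "linear_code K m D"
  shows "linear_code K m (C \<inter> D)"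
  using assms by (auto simp: linear_code_def)

lemma finite_linear_code:
  fixes K :: "'a::{field,finite} set"
  assumes "linear_code K m C"
  shows "finite C"
proof -
  have "C \<subseteq> vec_of_list ` {xs :: 'a list. set xs \<subseteq> UNIV \<and> length xs = m}"
  proof
    fix x assume "x \<in> C"
    then have "x = vec_of_list (list_of_vec x)" "length (list_of_vec x) = m"
      using linear_codeD(5)[OF assms] by (simp_all add: vec_list)
    then show "x \<in> vec_of_list ` {xs. set xs \<subseteq> UNIV \<and> length xs = m}"
      by blast
  qed
  then show ?thesis
    using finite_lists_length_eq[of "UNIV :: 'a set" m] by (meson finite_imageI finite_UNIV finite_subset)
qed

section \<open>Counting in subspaces and coverings by subspaces\<close>

text \<open>For \<open>v\<close> in \<open>W\<close> outside \<open>V\<close>, the translates of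
  \<open>V\<close> by the multiples \<open>a\<close> of \<open>v\<close>, \<open>a \<in> K\<close>,
  are pairwise disjoint subsets of \<open>W\<close>.\<close>

lemma card_proper_subcode:
  fixes K :: "'a::{field,finite} set"
  assumes K: "is_subfield K" and V: "linear_code K m V" and W: "linear_code K m W" and "V \<subset> W"
  shows "card K * card V \<le> card W"
proof -
  obtain v where v: "v \<in> W" "v \<notin> V"
    using \<open>V \<subset> W\<close> by blast
  have dims: "dim_vec v = m" "\<And>x. x \<in> V \<Longrightarrow> dim_vec x = m"
    using v linear_codeD(5)[OF W] linear_codeD(5)[OF V] by auto
  let ?h = "\<lambda>(a, x). a \<cdot>\<^sub>v v + x"
  have "inj_on ?h (K \<times> V)"
  proof (rule inj_onI, clarify)
    fix a x b y
    assume *: "a \<in> K" "x \<in> V" "b \<in> K" "y \<in> V" and eq: "a \<cdot>\<^sub>v v + x = b \<cdot>\<^sub>v v + y"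
    have coord: "a * v $ i + x $ i = b * v $ i + y $ i" if "i < m" for i
      using arg_cong[OF eq, of "\<lambda>u. u $ i"] that dims * by simp
    have "a = b"
    proof (rule ccontr)
      assume "a \<noteq> b"
      \<comment> \<open>Solving the equation for \<open>v\<close> would place \<open>v\<close> in
        \<open>V\<close>.\<close>
      have "v = inverse (a - b) \<cdot>\<^sub>v (y - x)"
      proof (rule eq_vecI)
        fix i assume "i < dim_vec (inverse (a - b) \<cdot>\<^sub>v (y - x))"
        then have "i < m" using dims * by simp
        then have "(a - b) * v $ i = y $ i - x $ i"
          using coord[of i] by (simp add: algebra_simps)
        then show "v $ i = (inverse (a - b) \<cdot>\<^sub>v (y - x)) $ i"
          using \<open>a \<noteq> b\<close> \<open>i < m\<close> dims * by (simp add: field_simps)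
      qed (use dims * in simp)
      moreover have "inverse (a - b) \<in> K" "y - x \<in> V"
        using * is_subfieldD[OF K] linear_code_diff[OF K V] by auto
      ultimately have "v \<in> V"
        using linear_codeD(4)[OF V] by simp
      with v show False by simp
    qed
    moreover have "x = y"
      using coord \<open>a = b\<close> dims * by (intro eq_vecI) auto
    ultimately show "a = b \<and> x = y" by simp
  qed
  then have "card (K \<times> V) = card (?h ` (K \<times> V))"
    by (simp add: card_image)
  also have "\<dots> \<le> card W"
    using v \<open>V \<subset> W\<close> linear_codeD(3,4)[OF W]
    by (intro card_mono[OF finite_linear_code[OF W]]) auto
  finally show ?thesis
    by (simp add: card_cartesian_product)
qed

lemma card_subfield_ge_2:
  fixes K :: "'a::{field,finite} set"
  assumes "is_subfield K"
  shows "2 \<le> card K"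
proof -
  have "card {0, 1 :: 'a} \<le> card K"
    using is_subfieldD(1,2)[OF assms] by (intro card_mono) auto
  then show ?thesis by simp
qed

text \<open>If no member contains \<open>W\<close>, each meets it in a proper subspace of at most
  |W|/q elements, q = |K|. All these subspaces share the zero vector, so at most q of them cover at
  most |W| - q of the |W| - 1 nonzero vectors, which is impossible as q >= 2.\<close>

lemma linear_code_covering:
  fixes K :: "'a::{field,finite} set"
  assumes K: "is_subfield K" and W: "linear_code K m W"
    and S: "finite S" "card S \<le> card K" "\<And>U. U \<in> S \<Longrightarrow> linear_code K m U"
    and cover: "W \<subseteq> \<Union>S"
  shows "\<exists>U\<in>S. W \<subseteq> U"
proof (rule ccontr)
  assume no: "\<not> ?thesis"
  let ?q = "card K"
  have finW: "finite W" by (rule finite_linear_code[OF W])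
  have zW: "0\<^sub>v m \<in> W" by (rule linear_codeD(2)[OF W])
  \<comment> \<open>Deleting the zero vector costs one element, which the factor \<open>?q\<close>
    turns into the summand \<open>?q\<close>.\<close>
  have bound: "?q * card ((U \<inter> W) - {0\<^sub>v m}) + ?q \<le> card W" if "U \<in> S" for U
  proof -
    have UW: "linear_code K m (U \<inter> W)"
      using linear_code_Int S(3) W that by blast
    have "?q * card (U \<inter> W) \<le> card W"
      using no that by (intro card_proper_subcode[OF K UW W]) auto
    moreover have "card (U \<inter> W) = Suc (card ((U \<inter> W) - {0\<^sub>v m}))"
      using card.remove[of "U \<inter> W" "0\<^sub>v m"] finW linear_codeD(2)[OF UW] by simp
    ultimately show ?thesis by simp
  qed
  \<comment> \<open>The member covering the zero vector yields \<open>?q \<le> card W\<close>, so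
    that the truncated difference \<open>card W - ?q\<close> below is a true one.\<close>
  obtain U0 where "U0 \<in> S" using cover zW by blast
  then have qW: "?q \<le> card W" using bound[of U0] by simp
  have "W - {0\<^sub>v m} \<subseteq> (\<Union>U\<in>S. (U \<inter> W) - {0\<^sub>v m})"
    using cover by blast
  then have "card (W - {0\<^sub>v m}) \<le> card (\<Union>U\<in>S. (U \<inter> W) - {0\<^sub>v m})"
    using S(1) finW by (intro card_mono) auto
  also have "\<dots> \<le> (\<Sum>U\<in>S. card ((U \<inter> W) - {0\<^sub>v m}))"
    by (rule card_UN_le[OF S(1)])
  finally have "?q * card (W - {0\<^sub>v m}) \<le> (\<Sum>U\<in>S. ?q * card ((U \<inter> W) - {0\<^sub>v m}))"
    by (simp add: sum_distrib_left[symmetric])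
  also have "\<dots> \<le> (\<Sum>U\<in>S. card W - ?q)"
    using bound by (intro sum_mono) (simp add: le_diff_conv2 qW)
  also have "\<dots> \<le> ?q * (card W - ?q)"
    using S(2) by simp
  finally have "card (W - {0\<^sub>v m}) \<le> card W - ?q"
    using card_subfield_ge_2[OF K] by (simp only: mult_le_cancel1)
  moreover have "card (W - {0\<^sub>v m}) = card W - 1"
    using zW by simp
  ultimately show False
    using card_subfield_ge_2[OF K] qW by linarith
qed

section \<open>Multisets of subspaces that cover every point equally often\<close>

lemma linear_code_mset_eq:
  fixes K :: "'a::{field,finite} set"
  assumes K: "is_subfield K"
    and "\<And>V. V \<in># M + N \<Longrightarrow> linear_code K m V"
    and "\<And>x. size {#V \<in># M. x \<in> V#} = size {#V \<in># N. x \<in> V#}"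
    and "size M \<le> card K"
  shows "M = N"
  using assms(2-)
proof (induction "size M" arbitrary: M N rule: less_induct)
  case less
  note codes = less.prems(1) and count = less.prems(2) and small = less.prems(3)
  \<comment> \<open>The zero vector lies in every member, so counting there compares the sizes; the
    bound on \<open>M\<close> thereby passes to \<open>N\<close>.\<close>
  have "{#V \<in># M. 0\<^sub>v m \<in> V#} = M" "{#V \<in># N. 0\<^sub>v m \<in> V#} = N"
    using codes linear_codeD(2) by (auto simp: filter_mset_eq_conv)
  then have size: "size M = size N"
    using count[of "0\<^sub>v m"] by simp
  show ?case
  proof (cases "M = {#}")
    case True
    then show ?thesis using size by simp
  next
    case False
    \<comment> \<open>\<open>W\<close> is maximal in both families together, and it is not known yet
      which of them contains it.\<close>
    then obtain W where W: "W \<in># M + N" and max: "\<And>U. U \<in># M + N \<Longrightarrow> W \<subseteq> U \<Longrightarrow> W = U"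
      using finite_has_maximal[of "set_mset (M + N)"] by auto
    \<comment> \<open>Stated for arbitrary \<open>A\<close> and \<open>B\<close> so that it applies
      in both directions. The covering lemma is used on the underlying set of \<open>B\<close>,
      which has at most as many members as \<open>B\<close> counted with multiplicity.\<close>
    have transfer: "W \<in># B"
      if A: "W \<in># A" and B: "set_mset B \<subseteq> set_mset (M + N)" "size B \<le> card K"
        and AB: "\<And>x. size {#V \<in># A. x \<in> V#} = size {#V \<in># B. x \<in> V#}" for A B
    proof -
      have "W \<subseteq> \<Union>(set_mset B)"
      proof
        fix x assume "x \<in> W"
        then have "{#V \<in># A. x \<in> V#} \<noteq> {#}"
          using A by (auto simp: filter_mset_eq_conv)
        then have "{#V \<in># B. x \<in> V#} \<noteq> {#}"
          using AB[of x] by (metis size_eq_0_iff_empty)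
        then show "x \<in> \<Union>(set_mset B)"
          by (auto elim!: multiset_nonemptyE)
      qed
      moreover have "card (set_mset B) \<le> card K"
        using B(2) size_mset_mono[OF mset_set_set_mset_msubset, of B] by simp
      ultimately obtain U where "U \<in># B" "W \<subseteq> U"
        using linear_code_covering[OF K codes[OF W], of "set_mset B"] B(1) codes by blast
      then show ?thesis
        using max[of U] B(1) by blast
    qed
    have "W \<in># M" "W \<in># N"
      using W transfer[of M N] transfer[of N M] count small size by auto
    then obtain M' N' where MN: "M = add_mset W M'" "N = add_mset W N'"
      by (meson multi_member_split)
    have "M' = N'"
    proof (rule less.hyps)
      show "size M' < size M" "size M' \<le> card K" using MN small by auto
      show "linear_code K m V" if "V \<in># M' + N'" for V
        using that codes MN by auto
      show "size {#V \<in># M'. x \<in> V#} = size {#V \<in># N'. x \<in> V#}" for x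
        using count[of x] MN by (auto split: if_splits)
    qed
    then show ?thesis using MN by simp
  qed
qed

section \<open>Extending linear bijections between subspaces of \<open>L\<close>\<close>

text \<open>
  Graphs of injective \<open>K\<close>-linear maps between subspaces of \<open>L\<close>; such a map is extended to all of
  \<open>L\<close> by enlarging its graph.
\<close>

definition partial_iso :: "'a::field set \<Rightarrow> ('a \<times> 'a) set \<Rightarrow> bool" where
  "partial_iso K G \<longleftrightarrow>
     (0, 0) \<in> G \<and>
     (\<forall>x y x' y'. (x, y) \<in> G \<longrightarrow> (x', y') \<in> G \<longrightarrow> (x + x', y + y') \<in> G) \<and>
     (\<forall>a\<in>K. \<forall>x y. (x, y) \<in> G \<longrightarrow> (a * x, a * y) \<in> G) \<and>
     (\<forall>x y. (x, y) \<in> G \<longrightarrow> (x = 0 \<longleftrightarrow> y = 0))"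

lemma partial_isoD:
  assumes "partial_iso K G"
  shows "(0, 0) \<in> G" "(x, y) \<in> G \<Longrightarrow> (x', y') \<in> G \<Longrightarrow> (x + x', y + y') \<in> G"
    "a \<in> K \<Longrightarrow> (x, y) \<in> G \<Longrightarrow> (a * x, a * y) \<in> G"
    "(x, y) \<in> G \<Longrightarrow> x = 0 \<longleftrightarrow> y = 0"
  using assms unfolding partial_iso_def by blast+

text \<open>Subtracting the two pairs reduces this to the kernel clause of
  \<open>partial_iso\<close>: the graph is single-valued and injective at once.\<close>

lemma partial_iso_eq_iff:
  assumes K: "is_subfield K" and G: "partial_iso K G" and "(x, y) \<in> G" "(x', y') \<in> G"
  shows "x = x' \<longleftrightarrow> y = y'"
proof -
  have "-1 \<in> K"
    using is_subfieldD(2,4)[OF K] by blast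
  then have "(x + (-1) * x', y + (-1) * y') \<in> G"
    using partial_isoD(2,3)[OF G] assms(3,4) by blast
  from partial_isoD(4)[OF G this] show ?thesis by simp
qed

text \<open>The new graph sends \<open>v\<close> to \<open>u\<close>. A vanishing
  \<open>s + a * v\<close> with \<open>a \<noteq> 0\<close> would put \<open>v\<close> into the old
  domain, and likewise \<open>u\<close> into the old range; so \<open>a = 0\<close> and the kernel
  clause of \<open>G\<close> applies.\<close>

lemma partial_iso_extend:
  assumes K: "is_subfield K" and G: "partial_iso K G" and v: "v \<notin> fst ` G" and u: "u \<notin> snd ` G"
  shows "partial_iso K {(x + a * v, y + a * u) |x y a. (x, y) \<in> G \<and> a \<in> K}" (is "partial_iso K ?H")
  unfolding partial_iso_def
proof (intro conjI allI impI ballI)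
  note Kc = is_subfieldD[OF K]
  show "(0, 0) \<in> ?H"
    using partial_isoD(1)[OF G] Kc(1) by force
  fix x y assume xy: "(x, y) \<in> ?H"
  then obtain s t a where s: "x = s + a * v" "y = t + a * u" "(s, t) \<in> G" "a \<in> K" by blast
  {
    fix x' y' assume "(x', y') \<in> ?H"
    then obtain s' t' a' where s': "x' = s' + a' * v" "y' = t' + a' * u" "(s', t') \<in> G" "a' \<in> K"
      by blast
    have "x + x' = (s + s') + (a + a') * v" "y + y' = (t + t') + (a + a') * u"
      using s s' by (simp_all add: algebra_simps)
    moreover have "(s + s', t + t') \<in> G" "a + a' \<in> K"
      using s s' partial_isoD(2)[OF G] Kc(3) by simp_all
    ultimately show "(x + x', y + y') \<in> ?H" by blast
  }
  {
    fix b assume "b \<in> K"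
    have "b * x = b * s + (b * a) * v" "b * y = b * t + (b * a) * u"
      using s by (simp_all add: algebra_simps)
    moreover have "(b * s, b * t) \<in> G" "b * a \<in> K"
      using s \<open>b \<in> K\<close> partial_isoD(3)[OF G] Kc(6) by simp_all
    ultimately show "(b * x, b * y) \<in> ?H" by blast
  }
  have "a = 0" if "x = 0 \<or> y = 0"
  proof (rule ccontr)
    assume "a \<noteq> 0"
    have "- inverse a \<in> K" using s Kc(4,7) by simp
    then have *: "(- inverse a * s, - inverse a * t) \<in> G"
      by (rule partial_isoD(3)[OF G _ s(3)])
    from that show False
    proof
      assume "x = 0"
      then have "s = - (a * v)" using s by (simp add: eq_neg_iff_add_eq_0)
      then have "v = - inverse a * s" using \<open>a \<noteq> 0\<close> by simp
      then show False using * v by force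
    next
      assume "y = 0"
      then have "t = - (a * u)" using s by (simp add: eq_neg_iff_add_eq_0)
      then have "u = - inverse a * t" using \<open>a \<noteq> 0\<close> by simp
      then show False using * u by force
    qed
  qed
  then show "x = 0 \<longleftrightarrow> y = 0"
    using s partial_isoD(4)[OF G] by auto
qed

text \<open>A maximal partial isomorphism \<open>H\<close> above \<open>G\<close> has domain and
  range of equal size. If the domain misses some \<open>v\<close>, the range misses some
  \<open>u\<close>, and adjoining the pair contradicts maximality; so \<open>H\<close> is the graph
  of an automorphism.\<close>

lemma partial_iso_imp_linear_aut:
  fixes K :: "'a::{field,finite} set"
  assumes K: "is_subfield K" and G: "partial_iso K G"
  shows "\<exists>g\<in>linear_aut K. \<forall>(x, y)\<in>G. g x = y"
proof -
  obtain H where H: "partial_iso K H" "G \<subseteq> H"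
    and max: "\<And>H'. partial_iso K H' \<Longrightarrow> H \<subseteq> H' \<Longrightarrow> H = H'"
    using finite_has_maximal2[of "{H. partial_iso K H}" G] G by auto
  note eq_iff = partial_iso_eq_iff[OF K H(1)]
  have "inj_on fst H" "inj_on snd H"
    using eq_iff by (auto simp: inj_on_def)
  then have cards: "card (fst ` H) = card (snd ` H)"
    by (simp add: card_image)
  have total: "fst ` H = UNIV"
  proof (rule ccontr)
    assume not_total: "fst ` H \<noteq> UNIV"
    then obtain v where v: "v \<notin> fst ` H" by blast
    have "snd ` H \<noteq> UNIV"
      using not_total cards by (metis card_eq_UNIV_imp_eq_UNIV finite)
    then obtain u where u: "u \<notin> snd ` H" by blast
    let ?H = "{(x + a * v, y + a * u) |x y a. (x, y) \<in> H \<and> a \<in> K}"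
    have "H \<subseteq> ?H"
      using is_subfieldD(1)[OF K] by force
    with max[OF partial_iso_extend[OF K H(1) v u]] have "H = ?H" .
    moreover have "(v, u) \<in> ?H"
      using partial_isoD(1)[OF H(1)] is_subfieldD(2)[OF K] by force
    ultimately show False using v by force
  qed
  then have "\<forall>x. \<exists>y. (x, y) \<in> H" by (force simp: image_iff)
  then obtain g where g: "\<And>x. (x, g x) \<in> H" by metis
  have gI: "g x = y" if "(x, y) \<in> H" for x y
    using eq_iff[OF g[of x] that] by simp
  have "inj g"
    using eq_iff[OF g g] by (auto simp: inj_def)
  then have "bij g"
    by (simp add: bij_def finite_UNIV_inj_surj)
  then have "g \<in> linear_aut K"
    using gI partial_isoD(2,3)[OF H(1)] g unfolding linear_aut_def by blast
  then show ?thesis using gI H(2) by blast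
qed

text \<open>Equality of the kernels is exactly what makes the pairs \<open>(h x, k x)\<close>
  satisfy the kernel clause of \<open>partial_iso\<close>.\<close>

lemma kernel_eq_imp_linear_aut:
  fixes K :: "'a::{field,finite} set" and h k :: "'a vec \<Rightarrow> 'a"
  assumes K: "is_subfield K" and C: "linear_code K m C"
    and add1: "\<And>x y. x \<in> C \<Longrightarrow> y \<in> C \<Longrightarrow> h (x + y) = h x + h y"
    and smult1: "\<And>a x. a \<in> K \<Longrightarrow> x \<in> C \<Longrightarrow> h (a \<cdot>\<^sub>v x) = a * h x"
    and add2: "\<And>x y. x \<in> C \<Longrightarrow> y \<in> C \<Longrightarrow> k (x + y) = k x + k y"
    and smult2: "\<And>a x. a \<in> K \<Longrightarrow> x \<in> C \<Longrightarrow> k (a \<cdot>\<^sub>v x) = a * k x"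
    and ker: "{x \<in> C. h x = 0} = {x \<in> C. k x = 0}"
  shows "\<exists>g\<in>linear_aut K. \<forall>x\<in>C. g (h x) = k x"
proof -
  let ?G = "(\<lambda>x. (h x, k x)) ` C"
  have "partial_iso K ?G"
    unfolding partial_iso_def
  proof (intro conjI allI impI ballI)
    have "h (0 \<cdot>\<^sub>v 0\<^sub>v m) = 0" "k (0 \<cdot>\<^sub>v 0\<^sub>v m) = 0" "0 \<cdot>\<^sub>v 0\<^sub>v m \<in> C"
      using smult1[of 0 "0\<^sub>v m"] smult2[of 0 "0\<^sub>v m"] linear_codeD(2,4)[OF C] is_subfieldD(1)[OF K]
      by auto
    then show "(0, 0) \<in> ?G" by (metis (no_types, lifting) image_eqI)
    fix x y assume xy: "(x, y) \<in> ?G"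
    then obtain s where s: "s \<in> C" "x = h s" "y = k s" by auto
    {
      fix x' y' assume "(x', y') \<in> ?G"
      then obtain s' where s': "s' \<in> C" "x' = h s'" "y' = k s'" by auto
      show "(x + x', y + y') \<in> ?G"
        using s s' add1 add2 linear_codeD(3)[OF C] by (intro image_eqI[of _ _ "s + s'"]) auto
    }
    {
      fix a assume "a \<in> K"
      then show "(a * x, a * y) \<in> ?G"
        using s smult1 smult2 linear_codeD(4)[OF C] by (intro image_eqI[of _ _ "a \<cdot>\<^sub>v s"]) auto
    }
    have "s \<in> {x \<in> C. h x = 0} \<longleftrightarrow> s \<in> {x \<in> C. k x = 0}" by (simp only: ker)
    then show "x = 0 \<longleftrightarrow> y = 0" using s by simp
  qed
  from partial_iso_imp_linear_aut[OF K this] show ?thesis by auto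
qed

section \<open>Extendibility for short codes\<close>

lemma hamming_weight_carrier:
  assumes "x \<in> carrier_vec m"
  shows "card {i. i < m \<and> x $ i = 0} + hamming_weight x = m"
proof -
  have "card {i. i < m \<and> x $ i = 0} + card {i. i < m \<and> x $ i \<noteq> 0}
      = card ({i. i < m \<and> x $ i = 0} \<union> {i. i < m \<and> x $ i \<noteq> 0})"
    by (rule card_Un_disjoint[symmetric]) auto
  also have "{i. i < m \<and> x $ i = 0} \<union> {i. i < m \<and> x $ i \<noteq> 0} = {..<m}" by auto
  finally show ?thesis using assms by (simp add: hamming_weight_def)
qed

lemma linear_isometryD:
  assumes "linear_isometry K m C f"
  shows "x \<in> C \<Longrightarrow> f x \<in> carrier_vec m" "x \<in> C \<Longrightarrow> y \<in> C \<Longrightarrow> f (x + y) = f x + f y"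
    "a \<in> K \<Longrightarrow> x \<in> C \<Longrightarrow> f (a \<cdot>\<^sub>v x) = a \<cdot>\<^sub>v f x"
    "x \<in> C \<Longrightarrow> y \<in> C \<Longrightarrow> hamming_dist (f x) (f y) = hamming_dist x y"
  using assms by (auto simp: linear_isometry_def)

lemma linear_isometry_zero:
  assumes K: "is_subfield K" and C: "linear_code K m C" and f: "linear_isometry K m C f"
  shows "f (0\<^sub>v m) = 0\<^sub>v m"
proof -
  have z: "0\<^sub>v m \<in> C" by (rule linear_codeD(2)[OF C])
  have smult: "0 \<cdot>\<^sub>v x = 0\<^sub>v m" if "x \<in> carrier_vec m" for x :: "'a vec"
    using that by (intro eq_vecI) auto
  have "f (0 \<cdot>\<^sub>v 0\<^sub>v m) = 0 \<cdot>\<^sub>v f (0\<^sub>v m)"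
    by (rule linear_isometryD(3)[OF f is_subfieldD(1)[OF K] z])
  then show ?thesis
    using smult linear_isometryD(1)[OF f z] by simp
qed

lemma linear_isometry_weight:
  assumes K: "is_subfield K" and C: "linear_code K m C" and f: "linear_isometry K m C f"
    and x: "x \<in> C"
  shows "hamming_weight (f x) = hamming_weight x"
proof -
  note z = linear_codeD(2)[OF C]
  have "f (0\<^sub>v m) = 0\<^sub>v m" by (rule linear_isometry_zero[OF K C f])
  moreover have "x \<in> carrier_vec m" "f x \<in> carrier_vec m"
    using linear_codeD(1)[OF C] linear_isometryD(1)[OF f] x by auto
  ultimately show ?thesis
    using linear_isometryD(4)[OF f x z] by (simp add: hamming_dist_def)
qed

lemma isometry_extendible:
  fixes K :: "'a::{field,finite} set"
  assumes K: "is_subfield K" and "m \<le> card K" and C: "linear_code K m C"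
    and f: "linear_isometry K m C f"
  shows "extendible K m C f"
proof -
  note Cc = linear_codeD[OF C] and fc = linear_isometryD[OF f]
  have fdim: "dim_vec (f x) = m" if "x \<in> C" for x using fc(1)[OF that] by simp
  have z: "f (0\<^sub>v m) $ i = 0" if "i < m" for i
    using linear_isometry_zero[OF K C f] that by simp
  define V where "V i = {x \<in> C. x $ i = 0}" for i
  define U where "U i = {x \<in> C. f x $ i = 0}" for i
  have V: "linear_code K m (V i)" if "i < m" for i
    using Cc that unfolding V_def linear_code_def by auto
  have U: "linear_code K m (U i)" if "i < m" for i
    using Cc that z fdim fc(2,3) unfolding U_def linear_code_def by auto
  let ?mset = "\<lambda>V. image_mset V (mset_set {..<m})"
  \<comment> \<open>Equal kernels at different coordinates are counted separately, so for
    \<open>x\<close> in \<open>C\<close> both families count zero coordinates.\<close>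
  have count: "size {#A \<in># ?mset W. x \<in> A#} = card {i. i < m \<and> x \<in> W i}"
    for W :: "nat \<Rightarrow> 'a vec set" and x
    by (simp add: filter_mset_image_mset filter_mset_mset_set lessThan_def)
  have "?mset U = ?mset V"
  proof (rule linear_code_mset_eq[OF K])
    show "linear_code K m A" if "A \<in># ?mset U + ?mset V" for A
      using that U V by auto
    show "size (?mset U) \<le> card K" using \<open>m \<le> card K\<close> by simp
    show "size {#A \<in># ?mset U. x \<in> A#} = size {#A \<in># ?mset V. x \<in> A#}" for x
    proof (cases "x \<in> C")
      case True
      have "card {i. i < m \<and> x $ i = 0} = card {i. i < m \<and> f x $ i = 0}"
        using hamming_weight_carrier[of x m] hamming_weight_carrier[of "f x" m] True Cc(1) fc(1)[OF True]
          linear_isometry_weight[OF K C f True] by auto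
      then show ?thesis using True by (simp add: count U_def V_def)
    qed (simp add: count U_def V_def)
  qed
  \<comment> \<open>Equality of the two multisets matches the indices; the orientation
    \<open>U i = V (\<pi> i)\<close> is the one \<open>monomial_map\<close> asks for.\<close>
  then obtain \<pi> where \<pi>: "\<pi> permutes {..<m}" and eq: "\<forall>i\<in>{..<m}. U i = V (\<pi> i)"
    using image_mset_eq_implies_permutes[of "{..<m}" U V] by blast
  have "\<exists>g\<in>linear_aut K. \<forall>x\<in>C. g (x $ \<pi> i) = f x $ i" if "i < m" for i
  proof -
    have "\<pi> i < m" using \<pi> that by (metis lessThan_iff permutes_in_image)
    then show ?thesis
      using that eq Cc(5) fc(2,3) fdim
      by (intro kernel_eq_imp_linear_aut[OF K C]) (auto simp: U_def V_def)
  qed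
  then obtain g where g: "\<And>i. i < m \<Longrightarrow> g i \<in> linear_aut K"
    and gf: "\<And>i x. i < m \<Longrightarrow> x \<in> C \<Longrightarrow> g i (x $ \<pi> i) = f x $ i"
    by metis
  show ?thesis
    unfolding extendible_def monomial_map_def
  proof (intro exI[of _ "\<lambda>u. vec m (\<lambda>i. g i (u $ \<pi> i))"] conjI ballI)
    show "vec m (\<lambda>i. g i (x $ \<pi> i)) = f x" if "x \<in> C" for x
      using gf that fdim by (intro eq_vecI) auto
  qed (use \<pi> g in blast)
qed

section \<open>A nonextendible isometry for every larger length\<close>

text \<open>
  Coordinates \<open>0, \<dots>, |K|\<close> of the code in the next proof are linear forms on \<open>K\<^sup>2\<close> whose kernels are the
  \<open>|K| + 1\<close> lines; every further coordinate, and every coordinate but the first of the image, is the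
  injective form \<open>(a, b) \<mapsto> a + \<omega> b\<close>, where \<open>\<omega> \<notin> K\<close>.
\<close>

lemma exists_nonextendible_isometry:
  fixes K :: "'a::{field,finite} set"
  assumes K: "is_subfield K" and "K \<noteq> UNIV" and m: "card K < m"
  shows "\<exists>C f. linear_code K m C \<and> linear_isometry K m C f \<and> \<not> extendible K m C f"
proof -
  note Kc = is_subfieldD[OF K]
  obtain \<omega> where \<omega>: "\<omega> \<notin> K" using \<open>K \<noteq> UNIV\<close> by blast
  define q where "q = card K"
  have q: "0 < q" "q < m" using card_subfield_ge_2[OF K] m by (auto simp: q_def)
  obtain e where e: "bij_betw e {..<q} K"
    using ex_bij_betw_nat_finite[of K] by (auto simp: q_def atLeast0LessThan)
  have eK: "e i \<in> K" if "i < q" for i using e that bij_betwE by blast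
  \<comment> \<open>1 and \<open>\<omega>\<close> are linearly independent over
    \<open>K\<close>.\<close>
  have form: "a + \<omega> * b = 0 \<longleftrightarrow> a = 0 \<and> b = 0" if "a \<in> K" "b \<in> K" for a b
  proof (cases "b = 0")
    case False
    have "a + \<omega> * b \<noteq> 0"
    proof
      assume "a + \<omega> * b = 0"
      then have "\<omega> = - a / b" using False by (simp add: field_simps eq_neg_iff_add_eq_0)
      then show False using \<omega> Kc(4)[of a] Kc(8)[of "- a" b] that by simp
    qed
    then show ?thesis using False by simp
  qed simp
  define c where "c a b = vec m (\<lambda>i. if i < q then a + e i * b else if i = q then b else a + \<omega> * b)"
    for a b
  define d where "d a b = vec m (\<lambda>i. if i = 0 then 0 else a + \<omega> * b)" for a b
  \<comment> \<open>Coordinate \<open>q\<close> of \<open>c a b\<close> is \<open>b\<close> and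
    coordinate 0 is \<open>a + e 0 * b\<close>, so the arguments passed to \<open>d\<close> are
    \<open>a\<close> and \<open>b\<close>.\<close>
  define f where "f u = d (u $ 0 - e 0 * u $ q) (u $ q)" for u
  define C where "C = {c a b |a b. a \<in> K \<and> b \<in> K}"
  have fc: "f (c a b) = d a b" for a b
    using q by (simp add: f_def c_def)
  have dim: "dim_vec (c a b) = m" "dim_vec (d a b) = m" for a b
    by (simp_all add: c_def d_def)
  have lin: "c a b + c a' b' = c (a + a') (b + b')" "d a b + d a' b' = d (a + a') (b + b')"
    "c a b - c a' b' = c (a - a') (b - b')" "d a b - d a' b' = d (a - a') (b - b')"
    "s \<cdot>\<^sub>v c a b = c (s * a) (s * b)" "s \<cdot>\<^sub>v d a b = d (s * a) (s * b)" for a b a' b' s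
    by (rule eq_vecI; simp add: c_def d_def algebra_simps)+
  have wt: "hamming_weight (c a b) = hamming_weight (d a b)" if ab: "a \<in> K" "b \<in> K" for a b
  proof (cases "a = 0 \<and> b = 0")
    case True
    then show ?thesis by (auto simp: hamming_weight_def c_def d_def intro!: arg_cong[of _ _ card] split: if_splits)
  next
    case False
    then have nz: "a + \<omega> * b \<noteq> 0" using form ab by simp
    \<comment> \<open>A nonzero point of the plane lies on exactly one of the lines: the one of
      coordinate \<open>q\<close> if \<open>b = 0\<close>, otherwise that of the \<open>j\<close>
      with \<open>e j = - a / b\<close>. Hence both weights are \<open>m - 1\<close>.\<close>
    have "\<exists>j<m. \<forall>i<m. c a b $ i = 0 \<longleftrightarrow> i = j"
    proof (cases "b = 0")
      case True
      then show ?thesis using q False by (intro exI[of _ q]) (auto simp: c_def)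
    next
      case b: False
      have "- a / b \<in> e ` {..<q}"
        using e Kc(4)[of a] Kc(8)[of "- a" b] ab by (simp add: bij_betw_def)
      then obtain j where j: "j < q" "e j = - a / b" by auto
      have "a + e i * b = 0 \<longleftrightarrow> i = j" if "i < q" for i
      proof -
        have "a + e i * b = 0 \<longleftrightarrow> e i = e j"
          using b unfolding j by (auto simp: field_simps eq_neg_iff_add_eq_0)
        then show ?thesis
          using e j that by (auto simp: bij_betw_def inj_on_def)
      qed
      then show ?thesis using j q b nz by (intro exI[of _ j]) (auto simp: c_def)
    qed
    then obtain j where j: "j < m" "\<And>i. i < m \<Longrightarrow> c a b $ i = 0 \<longleftrightarrow> i = j" by blast
    have "{i. i < dim_vec (c a b) \<and> c a b $ i \<noteq> 0} = {..<m} - {j}"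
      using j by (auto simp: dim)
    moreover have "{i. i < dim_vec (d a b) \<and> d a b $ i \<noteq> 0} = {..<m} - {0}"
      using nz by (auto simp: d_def)
    ultimately show ?thesis
      using j q by (simp add: hamming_weight_def)
  qed
  have cI: "c a b \<in> C" if "a \<in> K" "b \<in> K" for a b
    using that by (auto simp: C_def)
  have cE: "\<exists>a\<in>K. \<exists>b\<in>K. u = c a b" if "u \<in> C" for u
    using that by (auto simp: C_def)
  have "0\<^sub>v m = c 0 0" by (rule eq_vecI) (simp_all add: c_def)
  then have zero_mem: "0\<^sub>v m \<in> C" using cI Kc(1) by simp
  have code: "linear_code K m C"
    unfolding linear_code_def
  proof (intro conjI ballI subsetI)
    fix x assume "x \<in> C"
    then obtain a b where x: "x = c a b" "a \<in> K" "b \<in> K" using cE by blast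
    show "x \<in> carrier_vec m" unfolding x(1) by (rule carrier_vecI[OF dim(1)])
    show "s \<cdot>\<^sub>v x \<in> C" if "s \<in> K" for s
      using x that by (simp add: lin cI Kc(6))
    fix y assume "y \<in> C"
    then obtain a' b' where "y = c a' b'" "a' \<in> K" "b' \<in> K" using cE by blast
    then show "x + y \<in> C" using x by (simp add: lin cI Kc(3))
  qed (rule zero_mem)
  have iso: "linear_isometry K m C f"
    unfolding linear_isometry_def
  proof (intro conjI ballI)
    fix x assume "x \<in> C"
    then obtain a b where x: "x = c a b" "a \<in> K" "b \<in> K" using cE by blast
    show "f x \<in> carrier_vec m" unfolding x(1) fc by (rule carrier_vecI[OF dim(2)])
    show "f (s \<cdot>\<^sub>v x) = s \<cdot>\<^sub>v f x" for s
      using x by (simp add: lin fc)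
    fix y assume "y \<in> C"
    then obtain a' b' where y: "y = c a' b'" "a' \<in> K" "b' \<in> K" using cE by blast
    show "f (x + y) = f x + f y" using x y by (simp add: lin fc)
    show "hamming_dist (f x) (f y) = hamming_dist x y"
      using x y by (simp add: hamming_dist_def lin fc wt Kc(5))
  qed
  have "\<not> extendible K m C f"
  proof
    assume "extendible K m C f"
    then obtain \<pi> g where \<pi>: "\<pi> permutes {..<m}" and g: "\<And>i. i < m \<Longrightarrow> g i \<in> linear_aut K"
      and F: "\<And>x. x \<in> C \<Longrightarrow> f x = vec m (\<lambda>i. g i (x $ \<pi> i))"
      using code unfolding extendible_def monomial_map_def linear_code_def by (metis subsetD)
    have "\<pi> 0 < m" using \<pi> q by (metis lessThan_iff permutes_in_image less_trans)
    have "g 0 \<in> linear_aut K"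
      using g q by simp
    then have "inj (g 0)" "g 0 (0 + 0) = g 0 0 + g 0 0"
      unfolding linear_aut_def bij_def by blast+
    then have g0: "inj (g 0)" "g 0 0 = 0"
      by (simp, metis add.right_neutral add_left_cancel)
    \<comment> \<open>Coordinate 0 of every image is zero, so the injectivity of \<open>g 0\<close>
      forces coordinate \<open>\<pi> 0\<close> to vanish on all of \<open>C\<close>.\<close>
    have zero: "c a b $ \<pi> 0 = 0" if "a \<in> K" "b \<in> K" for a b
    proof -
      from arg_cong[OF F[OF cI[OF that]], of "\<lambda>u. u $ 0"] have "g 0 (c a b $ \<pi> 0) = 0"
        using q by (simp add: fc d_def)
      then show ?thesis using g0 by (metis injD)
    qed
    \<comment> \<open>No coordinate vanishes on \<open>C\<close>: \<open>c 0 1\<close> is nonzero at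
      \<open>q\<close>, and \<open>c 1 0\<close> is nonzero at all other places.\<close>
    show False
    proof (cases "\<pi> 0 = q")
      case True
      then show False using zero[of 0 1] Kc(1,2) q by (simp add: c_def)
    next
      case False
      then show False using zero[of 1 0] Kc(1,2) \<open>\<pi> 0 < m\<close> by (auto simp: c_def split: if_splits)
    qed
  qed
  with code iso show ?thesis by blast
qed

theorem theorem18:
  fixes K :: "'a::{field,finite} set"
  assumes "is_subfield K" and "K \<noteq> UNIV"
  shows "(\<forall>m C f. 0 < m \<and> m \<le> card K \<and> linear_code K m C \<and> linear_isometry K m C f
            \<longrightarrow> extendible K m C f) \<and>
         (\<forall>m > card K. \<exists>C f. linear_code K m C \<and> linear_isometry K m C f
            \<and> \<not> extendible K m C f)"
  using isometry_extendible[OF assms(1)] exists_nonextendible_isometry[OF assms] by blast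

end
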